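(* Let $I\subset\mathbb{R}$ be a closed and bounded interval equipped with an absolutely continuous probability measure $\varrho$ with a bounded and continuous weight function $r$, i.e. $d\varrho(\alpha)=r(\alpha)\,d\alpha$. Let $f,g\in C^1(I)$ be real-valued, let $f^*,g^*$ be their decreasing rearrangements with respect to $\varrho$, and suppose that $|(f^* )'|>\tau$ and $|(g^* )'|>\tau$ for some $\tau>0$. Let $\mu=f_*\varrho$ and $\nu=g_*\varrho$. Then for every integer $k\ge 1$, $$W_2(\mu,\nu)\ge A_k\left|\mathbb{E}_\varrho f^k-\mathbb{E}_\varrho g^k\right|,$$ where $$A_k=\frac{\sqrt{2k-1}}{k}\left(M^{2k-1}-m^{2k-1}\right)^{-\frac12}\tau^{\frac12}\,\|r\|_\infty^{-\frac12},\qquad M=\max_{x\in I}\max\{f(x),g(x)\},\quad m=\min_{x\in I}\min\{f(x),g(x)\},$$ and $A_k$ is a positive number.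
   Context: $\mathbb{E}_\varrho f^k=\int_I f(\alpha)^k\,d\varrho(\alpha)$. The pushforward is $f_*\varrho(B)=\varrho(f^{-1}(B))$ for Borel $B\subseteq\mathbb{R}$. Decreasing rearrangement: $f^*$ is the monotonically decreasing function on $I$ with the same measure of super-level sets as $f$, that is, $\varrho(\{\alpha\in I: f^*(\alpha)\ge t\})=\varrho(\{\alpha\in I: f(\alpha)\ge t\})$ for all $t\in\mathbb{R}$; similarly for $g^*$. The conditions on the derivatives are understood at the points where the derivatives of the monotone functions $f^*,g^*$ exist (almost every point of $I$). For Borel probability measures $\mu,\nu$ on $\mathbb{R}$ with finite second moments, $W_2(\mu,\nu)=\left[\inf_{\gamma\in\Gamma}\int_{\mathbb{R}^2}|x-y|^2\,d\gamma(x,y)\right]^{1/2}$, where $\Gamma$ is the set of Borel measures on $\mathbb{R}^2$ whose first and second marginals are $\mu$ and $\nu$. *)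

theory Defs
  imports "HOL-Probability.Probability"
begin

(* The measure is carried by the subspace I, so values of functions outside I are irrelevant
   (in particular for measurability in push-forwards). *)
definition weighted_measure :: "real set \<Rightarrow> (real \<Rightarrow> real) \<Rightarrow> real measure" where
  "weighted_measure I r = density (restrict_space lborel I) (\<lambda>x. ennreal (r x))"

(* Continuous differentiability on I itself, one-sided at endpoints; the library's
   C1_differentiable_on asks for two-sided derivatives and so depends on values outside I. *)
definition C1_on :: "real set \<Rightarrow> (real \<Rightarrow> real) \<Rightarrow> bool" where
  "C1_on I f \<longleftrightarrow>
     (\<exists>f'. (\<forall>x\<in>I. (f has_real_derivative f' x) (at x within I)) \<and> continuous_on I f')"

(* A predicate rather than a function: the two conditions leave the values at jumps and on
   sets of measure zero undetermined. *)
definition decreasing_rearrangement ::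
    "real measure \<Rightarrow> (real \<Rightarrow> real) \<Rightarrow> (real \<Rightarrow> real) \<Rightarrow> bool" where
  "decreasing_rearrangement \<rho> f fs \<longleftrightarrow>
     antimono_on (space \<rho>) fs \<and>
     (\<forall>t. measure \<rho> {x \<in> space \<rho>. fs x \<ge> t} = measure \<rho> {x \<in> space \<rho>. f x \<ge> t})"

definition couplings :: "real measure \<Rightarrow> real measure \<Rightarrow> (real \<times> real) measure set" where
  "couplings \<mu> \<nu> =
     {\<gamma>. sets \<gamma> = sets borel \<and> distr \<gamma> borel fst = \<mu> \<and> distr \<gamma> borel snd = \<nu>}"

(* For Borel probability measures with finite second moments the infimum is finite, so
   enn2real loses nothing. *)
definition W2 :: "real measure \<Rightarrow> real measure \<Rightarrow> real" where
  "W2 \<mu> \<nu> =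
     sqrt (enn2real (INF \<gamma>\<in>couplings \<mu> \<nu>. \<integral>\<^sup>+ (x, y). ennreal (\<bar>x - y\<bar>\<^sup>2) \<partial>\<gamma>))"

end

theory Submission
  imports Defs
begin

text \<open>
  The superlevel function \<open>H(s) = \<rho>{f \<ge> s}\<close> determines \<open>\<mu>\<close>. Since \<open>f*\<close> decreases with slope
  at least \<open>\<tau>\<close>, the set where \<open>s \<le> f* < t\<close> has diameter at most \<open>(t - s)/\<tau>\<close>, so \<open>H\<close> is Lipschitz with
  constant \<open>L = \<parallel>r\<parallel>/\<tau>\<close>; the same holds for the superlevel function \<open>G\<close> of \<open>g\<close>. The slope bound is
  where Lebesgue's differentiation theorem enters: the inverse \<open>w\<close> of the expanding function
  \<open>id - f*\<close> is 1-Lipschitz, hence an indefinite integral, and \<open>w' \<le> 1/(1 + \<tau>)\<close> almost everywhere.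

  No optimal coupling is needed. For any coupling \<open>(X, Y)\<close>, layering \<open>(Y - X)\<^sup>2\<close> on \<open>X < Y\<close> as
  \<open>2 \<integral>\<integral> [0 \<le> t, X < s, s + t \<le> Y] dt ds\<close> and using
  \<open>P(X < s, s + t \<le> Y) \<ge> G(s + t) - H(s) \<ge> G(s) - H(s) - L t\<close> gives \<open>\<integral>(H - G)\<^sup>2 \<le> L E(X - Y)\<^sup>2\<close>.
  The \<open>k\<close>-th moments differ by \<open>\<integral> k s\<^bsup>k-1\<^esup> (H - G) ds\<close> over \<open>[m, M]\<close>, and Cauchy-Schwarz finishes.
\<close>

section \<open>Slopes of monotone functions from their pointwise derivatives\<close>

text \<open>Lebesgue differentiation gives convergence of the averages of \<open>q\<close> over
  intervals to the right of \<open>x\<close>. Applied to the reflection of \<open>q\<close> it also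
  handles intervals to the left, at the price of a reflected null set.\<close>

lemma AE_DERIV_of_integral_increments:
  fixes q W :: "real \<Rightarrow> real"
  assumes int: "\<And>a b. q integrable_on {a..b}"
    and W: "\<And>a b. a \<le> b \<Longrightarrow> W b - W a = integral {a..b} q"
  obtains N where "negligible N" "\<And>x. x \<notin> N \<Longrightarrow> DERIV W x :> q x"
proof -
  obtain N where N: "negligible N"
    "\<And>x e. x \<notin> N \<Longrightarrow> 0 < e \<Longrightarrow> \<exists>d>0. \<forall>h. 0 < h \<and> h < d \<longrightarrow> \<bar>integral {x..x+h} q / h - q x\<bar> < e"
    using integrable_ccontinuous_explicit[of q] int
    by (auto simp: divide_inverse mult.commute)
  have "(\<lambda>x. q (- x)) integrable_on {a..b}" for a b
    using int[of "-b" "-a"] Henstock_Kurzweil_Integration.integrable_reflect_real[of q "-a" "-b"] by simp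
  then obtain N' where N': "negligible N'"
    "\<And>x e. x \<notin> N' \<Longrightarrow> 0 < e \<Longrightarrow> 
       \<exists>d>0. \<forall>h. 0 < h \<and> h < d \<longrightarrow> \<bar>integral {x..x+h} (\<lambda>x. q (- x)) / h - q (- x)\<bar> < e"
    using integrable_ccontinuous_explicit[of "\<lambda>x. q (- x)"]
    by (auto simp: divide_inverse mult.commute)
  have refl: "integral {-x..h-x} (\<lambda>x. q (- x)) = integral {x-h..x} q" for x h
    using Henstock_Kurzweil_Integration.integral_reflect_real[of x "x - h" q]
    by (simp add: algebra_simps)
  have neg: "negligible (uminus ` N')"
    by (intro negligible_locally_Lipschitz_image N' exI[of _ UNIV] exI[of _ 1])
      (auto simp: abs_minus_commute)
  show thesis
  proof
    show "negligible (N \<union> uminus ` N')" using N neg by auto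
    fix x assume x: "x \<notin> N \<union> uminus ` N'"
    then have x': "- x \<notin> N'" by force
    show "DERIV W x :> q x"
      unfolding DERIV_def LIM_eq
    proof (intro allI impI)
      fix e :: real assume e: "0 < e"
      obtain d where d: "d > 0" "\<And>h. 0 < h \<Longrightarrow> h < d \<Longrightarrow> \<bar>integral {x..x+h} q / h - q x\<bar> < e"
        using N(2)[of x e] x e by auto
      obtain d' where d': "d' > 0" 
        "\<And>h. 0 < h \<Longrightarrow> h < d' \<Longrightarrow> \<bar>integral {x-h..x} q / h - q x\<bar> < e"
        using N'(2)[of "-x" e] x' e by (auto simp: refl)
      show "\<exists>s>0. \<forall>h. h \<noteq> 0 \<and> norm (h - 0) < s \<longrightarrow> norm ((W (x + h) - W x) / h - q x) < e"
      proof (intro exI[of _ "min d d'"] conjI allI impI)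
        fix h :: real assume h: "h \<noteq> 0 \<and> norm (h - 0) < min d d'"
        show "norm ((W (x + h) - W x) / h - q x) < e"
        proof (cases "h > 0")
          case True
          then show ?thesis using d(2)[of h] h W[of x "x+h"] by auto
        next
          case False
          then have "W x - W (x + h) = integral {x - (-h)..x} q" using h W[of "x+h" x] by auto
          then have "(W (x + h) - W x) / h = integral {x - (-h)..x} q / (-h)"
            by (simp add: field_simps)
          then show ?thesis using d'(2)[of "-h"] h False by auto
        qed
      qed (use d d' in auto)
    qed
  qed
qed

text \<open>Since \<open>v\<close> may jump, its inverse is taken as a supremum, which stays
  constant across each jump. Expansion of \<open>v\<close> turns into contraction of
  \<open>w\<close>.\<close>

lemma expanding_inverse:
  fixes v :: "real \<Rightarrow> real"
  assumes v: "\<And>x y. x \<le> y \<Longrightarrow> y - x \<le> v y - v x"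
  obtains w where "\<And>x. w (v x) = x" "mono w" "\<And>y z. y \<le> z \<Longrightarrow> w z - w y \<le> z - y"
    "\<And>x z. v x \<le> z \<Longrightarrow> x \<le> w z" "\<And>x z. z \<le> v x \<Longrightarrow> w z \<le> x"
proof -
  define w where "w z = Sup {x. v x \<le> z}" for z
  have ne: "{x. v x \<le> z} \<noteq> {}" for z
    \<comment> \<open>To the left of 0 the function \<open>v\<close> lies below
      \<open>v 0 + x\<close>, so this witness satisfies \<open>v x \<le> z\<close>.\<close>
    using v[of "min 0 (z - v 0)" 0] by (intro ex_in_conv[THEN iffD1] exI[of _ "min 0 (z - v 0)"]) auto
  have ub: "x \<le> max 0 (z - v 0)" if "v x \<le> z" for x z
    using v[of 0 x] that by (cases "x \<ge> 0") auto
  have bdd: "bdd_above {x. v x \<le> z}" for z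
    using ub by (intro bdd_aboveI) auto
  have ge: "x \<le> w z" if "v x \<le> z" for x z
    unfolding w_def using that by (intro cSup_upper bdd) auto
  have le: "w z \<le> y" if "\<And>x. v x \<le> z \<Longrightarrow> x \<le> y" for y z
    unfolding w_def using that by (intro cSup_least ne) auto
  have le': "w z \<le> x" if "z \<le> v x" for x z
  proof (rule le)
    fix y assume "v y \<le> z" then show "y \<le> x" using v[of x y] that by (cases "x \<le> y") auto
  qed
  show thesis
  proof
    show "w (v x) = x" for x using ge[of x "v x"] le'[of "v x" x] by auto
    show "mono w" by (intro monoI le) (use ge in force)
    show "w z - w y \<le> z - y" if "y \<le> z" for y z
    proof -
      have "w z \<le> w y + (z - y)"
      proof (rule le, rule ccontr)
        fix x assume x: "v x \<le> z" "\<not> x \<le> w y + (z - y)"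
        \<comment> \<open>Moving left by \<open>z - y\<close> lowers \<open>v\<close> by at least
          \<open>z - y\<close>, so \<open>x'\<close> belongs to the set whose supremum is
          \<open>w y\<close>.\<close>
        define x' where "x' = x - (z - y)"
        have "v x' \<le> y" using v[of x' x] x that by (auto simp: x'_def)
        then show False using ge[of x' y] x by (auto simp: x'_def)
      qed
      then show ?thesis by simp
    qed
  qed (fact ge le')+
qed

text \<open>Jumps and a singular part of \<open>u\<close> can only enlarge its increments. Passing
  to the inverse \<open>w\<close> makes this visible: jumps of \<open>u\<close> become flat pieces
  of \<open>w\<close>, and integrating \<open>w' \<le> c\<close> yields
  \<open>y - x \<le> c * (v y - v x)\<close>, which rearranges to the claim.\<close>

lemma expanding_if_deriv_ge:
  fixes u :: "real \<Rightarrow> real"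
  assumes u: "mono u" and "0 \<le> \<tau>"
    and deriv: "\<And>x D. a < x \<Longrightarrow> x < b \<Longrightarrow> DERIV u x :> D \<Longrightarrow> \<tau> \<le> D"
    and xy: "a \<le> x" "x \<le> y" "y \<le> b"
  shows "\<tau> * (y - x) \<le> u y - u x"
proof -
  \<comment> \<open>Adding the identity makes the function expanding; \<open>c\<close> is the
    reciprocal of the least slope \<open>1 + \<tau>\<close> that \<open>v\<close> can then
    have.\<close>
  define v where "v t = u t + t" for t
  define c where "c = 1 / (1 + \<tau>)"
  have c: "c > 0" using \<open>0 \<le> \<tau>\<close> by (simp add: c_def)
  have v: "t - s \<le> v t - v s" if "s \<le> t" for s t
    using monoD[OF u that] by (simp add: v_def)
  have "mono v" using v by (intro monoI) force
  then have [measurable]: "v \<in> borel_measurable borel" by (rule borel_measurable_mono)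
  obtain w where w: "\<And>x. w (v x) = x" "mono w" "\<And>y z. y \<le> z \<Longrightarrow> w z - w y \<le> z - y"
    "\<And>x z. v x \<le> z \<Longrightarrow> x \<le> w z" "\<And>x z. z \<le> v x \<Longrightarrow> w z \<le> x"
    using expanding_inverse[of v] v by blast
  \<comment> \<open>The Stieltjes measure of \<open>w\<close>, since \<open>v -` {s..t}\<close> is \<open>{w s..w t}\<close> up to endpoints;
    its density \<open>q\<close> is \<open>w'\<close> almost everywhere.\<close>
  define N where "N = distr lborel borel v"
  \<comment> \<open>The preimage of \<open>B\<close> under \<open>v\<close> lies in the image of
    \<open>B\<close> under the 1-Lipschitz map \<open>w\<close>, and such maps preserve null
    sets.\<close>
  have ac: "absolutely_continuous lborel N"
    unfolding absolutely_continuous_def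
  proof
    fix B :: "real set" assume B: "B \<in> null_sets lborel"
    then have [measurable]: "B \<in> sets borel" by auto
    have "negligible B" using B by (simp add: negligible_iff_null_sets null_sets_completionI)
    then have "negligible (w ` B)"
    proof (rule negligible_locally_Lipschitz_image[rotated])
      have "\<bar>w y - w x\<bar> \<le> \<bar>y - x\<bar>" for x y
        using w(3)[of x y] w(3)[of y x] monoD[OF w(2), of x y] monoD[OF w(2), of y x] by linarith
      then show "\<exists>T C. open T \<and> x \<in> T \<and> (\<forall>y\<in>B \<inter> T. norm (w y - w x) \<le> C * norm (y - x))" for x
        by (intro exI[of _ UNIV] exI[of _ 1]) auto
    qed auto
    moreover have "v -` B \<subseteq> w ` B" using w(1) by (metis image_eqI subsetI vimageE)
    ultimately have "negligible (v -` B)" by (rule negligible_subset)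
    moreover have "v -` B \<in> sets borel" using measurable_sets[of v borel borel B] by auto
    ultimately have "v -` B \<in> null_sets lborel"
      by (simp add: negligible_iff_null_sets null_sets_completion_iff)
    then show "B \<in> null_sets N"
      by (simp add: N_def null_sets_distr_iff)
  qed
  then obtain Q where [measurable]: "Q \<in> borel_measurable borel" and Q: "density lborel Q = N"
    using sigma_finite_measure.Radon_Nikodym[OF sigma_finite_lborel, of N] by (auto simp: N_def)
  have meas: "(\<integral>\<^sup>+ z. Q z * indicator {s..t} z \<partial>lborel) = ennreal (w t - w s)" if "s \<le> t" for s t
  proof -
    have wst: "w s \<le> w t" using w(2) that by (rule monoD)
    have vim: "v -` {s..t} \<in> sets borel" using measurable_sets[of v borel borel "{s..t}"] by auto
    have "(\<integral>\<^sup>+ z. Q z * indicator {s..t} z \<partial>lborel) = emeasure N {s..t}"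
      by (simp add: Q[symmetric] emeasure_density)
    also have "\<dots> = emeasure lborel (v -` {s..t})"
      by (simp add: N_def emeasure_distr)
    also have "\<dots> = ennreal (w t - w s)"
    proof (rule antisym)
      have "v -` {s..t} \<subseteq> {w s..w t}" using w(4,5) by auto
      then show "emeasure lborel (v -` {s..t}) \<le> ennreal (w t - w s)"
        using emeasure_mono[of "v -` {s..t}" "{w s..w t}" lborel] wst by simp
      have "x \<in> v -` {s..t}" if "x \<in> {w s<..<w t}" for x
        using that w(4)[of x s] w(5)[of t x] by (cases "v x \<le> s"; cases "t \<le> v x") auto
      then have "{w s<..<w t} \<subseteq> v -` {s..t}" by blast
      then show "ennreal (w t - w s) \<le> emeasure lborel (v -` {s..t})"
        using emeasure_mono[of "{w s<..<w t}" "v -` {s..t}" lborel] wst vim by simp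
    qed
    finally show ?thesis .
  qed
  \<comment> \<open>A Radon-Nikodym density may take the value infinity. Its integrals over bounded
    intervals are finite, so this happens only on a null set and the real-valued \<open>q\<close>
    loses nothing.\<close>
  have "AE z in lborel. \<forall>n::nat. Q z * indicator {- real n..real n} z \<noteq> \<infinity>"
    unfolding AE_all_countable
    by (intro allI nn_integral_noteq_infinite) (auto simp: meas)
  then have fin: "AE z in lborel. Q z \<noteq> \<infinity>"
  proof eventually_elim
    case (elim z)
    obtain n :: nat where "\<bar>z\<bar> \<le> real n" using real_arch_simple by blast
    then have "indicator {- real n..real n} z = (1 :: ennreal)" by (auto simp: indicator_def)
    then show ?case using elim[rule_format, of n] by simp
  qed
  define q where "q z = enn2real (Q z)" for z
  have [measurable]: "q \<in> borel_measurable borel" unfolding q_def by measurable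
  have q_int: "(q has_integral (w t - w s)) {s..t}" if "s \<le> t" for s t
  proof -
    have eq: "(\<integral>\<^sup>+ z. ennreal (q z * indicator {s..t} z) \<partial>lborel)
        = (\<integral>\<^sup>+ z. Q z * indicator {s..t} z \<partial>lborel)"
      by (intro nn_integral_cong_AE, use fin in eventually_elim)
        (auto simp: q_def indicator_def less_top)
    have "((\<lambda>z. q z * indicator {s..t} z) has_integral (w t - w s)) UNIV"
    proof (rule nn_integral_has_integral)
      show "0 \<le> q z * indicator {s..t} z" for z by (simp add: q_def)
    qed (use eq monoD[OF w(2) that] in \<open>auto simp: meas that\<close>)
    moreover have "(\<lambda>z. q z * indicator {s..t} z) = (\<lambda>z. if z \<in> {s..t} then q z else 0)"
      by (auto simp: indicator_def)
    ultimately show ?thesis by (simp only: has_integral_restrict_UNIV)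
  qed
  have q_int': "q integrable_on {s..t}" for s t
    using q_int[of s t] by (cases "s \<le> t") auto
  obtain Z where Z: "negligible Z" "\<And>z. z \<notin> Z \<Longrightarrow> DERIV w z :> q z"
    using AE_DERIV_of_integral_increments[of q w] q_int' integral_unique[OF q_int] by metis
  \<comment> \<open>Where \<open>q z > 0\<close>, \<open>w\<close> passes strictly through the value
    \<open>p = w z\<close>, so \<open>v\<close> cannot jump at \<open>p\<close>. Hence
    \<open>v\<close> is continuous there with \<open>v p = z\<close> and derivative
    \<open>1 / q z\<close>, which is at least \<open>1 + \<tau>\<close>.\<close>
  have q_le: "q z \<le> c" if z: "z \<notin> Z" "v a < z" "z < v b" for z
  proof (cases "q z > 0")
    case False
    then show ?thesis using c by simp
  next
    case True
    define p where "p = w z"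
    obtain d1 where d1: "d1 > 0" "\<And>h. 0 < h \<Longrightarrow> h < d1 \<Longrightarrow> p < w (z + h)"
      using DERIV_pos_inc_right[OF Z(2)[OF z(1)] True] by (auto simp: p_def)
    obtain d2 where d2: "d2 > 0" "\<And>h. 0 < h \<Longrightarrow> h < d2 \<Longrightarrow> w (z - h) < p"
      using DERIV_pos_inc_left[OF Z(2)[OF z(1)] True] by (auto simp: p_def)
    have near: "\<exists>s>0. \<forall>t. \<bar>t - p\<bar> < s \<longrightarrow> \<bar>v t - z\<bar> < e" if "e > 0" for e
    proof -
      define h where "h = min e (min d1 d2) / 2"
      have h: "0 < h" "h < d1" "h < d2" "h < e" using that d1(1) d2(1) by (auto simp: h_def)
      have "\<bar>v t - z\<bar> < e" if "\<bar>t - p\<bar> < min (w (z + h) - p) (p - w (z - h))" for t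
        using w(4)[of t "z - h"] w(5)[of "z + h" t] that h by linarith
      then show ?thesis using d1(2)[of h] d2(2)[of h] h
        by (intro exI[of _ "min (w (z + h) - p) (p - w (z - h))"]) auto
    qed
    have vp: "v p = z"
    proof (rule ccontr)
      assume "v p \<noteq> z"
      then show False using near[of "\<bar>v p - z\<bar>"] by (auto dest!: spec[of _ p])
    qed
    have "isCont v p" unfolding continuous_at_eps_delta using near by (auto simp: vp dist_real_def)
    then have "DERIV v p :> inverse (q z)"
      using DERIV_inverse_function[where f = w and g = v and x = p and D = "q z" and a = "p - 1" and b = "p + 1"] Z(2)[OF z(1)] True w(1)
      by (auto simp: vp)
    then have "DERIV (\<lambda>t. v t - t) p :> inverse (q z) - 1"
      by (auto intro!: derivative_eq_intros)
    then have "DERIV u p :> inverse (q z) - 1" by (simp add: v_def)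
    moreover have "a < p" "p < b" using z vp monoD[OF \<open>mono v\<close>, of p a] monoD[OF \<open>mono v\<close>, of b p]
      by force+
    ultimately have "\<tau> \<le> inverse (q z) - 1" using deriv by blast
    then show ?thesis using True \<open>0 \<le> \<tau>\<close> by (simp add: c_def field_simps)
  qed
  have vxy: "v a \<le> v x" "v x \<le> v y" "v y \<le> v b" using monoD[OF \<open>mono v\<close>] xy by auto
  \<comment> \<open>The bound on \<open>q\<close> is known only off \<open>Z\<close> and strictly
    between \<open>v a\<close> and \<open>v b\<close>; resetting \<open>q\<close> to
    \<open>c\<close> on this null set makes it hold everywhere on the interval.\<close>
  define q' where "q' z = (if z \<in> Z \<union> {v a, v b} then c else q z)" for z
  have "(q' has_integral (y - x)) {v x..v y}"
    using Z(1) q_int[OF vxy(2)] 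
    by (intro has_integral_spike[of "Z \<union> {v a, v b}" _ q' q]) (auto simp: q'_def w(1))
  moreover have "((\<lambda>_. c) has_integral c * (v y - v x)) {v x..v y}"
    using has_integral_const_real[of c "v x" "v y"] vxy by (simp add: mult.commute)
  ultimately have "y - x \<le> c * (v y - v x)"
  proof (rule has_integral_le)
    fix z assume z: "z \<in> {v x..v y}"
    show "q' z \<le> c" using q_le[of z] z vxy by (auto simp: q'_def)
  qed
  then show ?thesis using \<open>0 \<le> \<tau>\<close> by (simp add: c_def v_def field_simps)
qed

section \<open>Coupling cost and tail functions\<close>

text \<open>For \<open>s\<close> between \<open>x\<close> and \<open>y\<close> the layer in
  \<open>t\<close> is \<open>{0..y - s}\<close>, and integrating \<open>2 * (y - s)\<close> over
  \<open>s\<close> gives the square. If \<open>y < x\<close> there are no layers, matching the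
  positive part.\<close>

lemma nn_integral_square_layers_le:
  fixes x y :: real
  shows "(\<integral>\<^sup>+ s. \<integral>\<^sup>+ t. 2 * indicator {t. 0 \<le> t \<and> x < s \<and> s + t \<le> y} t \<partial>lborel \<partial>lborel)
    \<le> ennreal ((max 0 (y - x))\<^sup>2)"
proof (cases "x \<le> y")
  case True
  have "(\<integral>\<^sup>+ t. 2 * indicator {t. 0 \<le> t \<and> x < s \<and> s + t \<le> y} t \<partial>lborel)
      \<le> ennreal (2 * (y - s)) * indicator {x..y} s" for s
  proof -
    have "{t. 0 \<le> t \<and> x < s \<and> s + t \<le> y} = (if x < s then {0..y - s} else {})" by auto
    then have "(\<integral>\<^sup>+ t. 2 * indicator {t. 0 \<le> t \<and> x < s \<and> s + t \<le> y} t \<partial>lborel)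
        = 2 * emeasure lborel (if x < s then {0..y - s} else {})"
      by (simp only:) (rule nn_integral_cmult_indicator, simp)
    then show ?thesis
      by (cases "s \<le> y") (auto simp: emeasure_lborel_Icc_eq ennreal_mult' indicator_def
          simp del: right_diff_distrib_numeral)
  qed
  then have "(\<integral>\<^sup>+ s. \<integral>\<^sup>+ t. 2 * indicator {t. 0 \<le> t \<and> x < s \<and> s + t \<le> y} t \<partial>lborel \<partial>lborel)
    \<le> (\<integral>\<^sup>+ s. ennreal (2 * (y - s)) * indicator {x..y} s \<partial>lborel)"
    by (intro nn_integral_mono)
  also have "\<dots> = - (y - y)\<^sup>2 - (- (y - x)\<^sup>2)"
    using True by (intro nn_integral_FTC_Icc) (auto intro!: derivative_eq_intros)
  finally show ?thesis using True by simp
next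
  case False
  then have *: "{t. 0 \<le> t \<and> x < s \<and> s + t \<le> y} = {}" for s by auto
  show ?thesis unfolding * by simp
qed

context prob_space
begin

text \<open>Where the tail of \<open>Y\<close> exceeds that of \<open>X\<close> by \<open>p\<close>,
  the Lipschitz bound on the tail of \<open>Y\<close> keeps an excess of at least
  \<open>p - L * t\<close> at distance \<open>t\<close>. This mass must travel across the whole gap
  from \<open>s\<close> to \<open>s + t\<close>, and summing over \<open>t\<close> produces
  \<open>p\<^sup>2 / L\<close>.\<close>

lemma nn_integral_tail_excess_le:
  fixes X Y :: "'a \<Rightarrow> real"
  assumes [measurable]: "X \<in> borel_measurable M" "Y \<in> borel_measurable M"
    and "0 < L"
    and lip: "\<And>s t. s \<le> t \<Longrightarrow> \<P>(\<omega> in M. s \<le> Y \<omega>) - \<P>(\<omega> in M. t \<le> Y \<omega>) \<le> L * (t - s)"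
  shows "(\<integral>\<^sup>+ s. ennreal ((max 0 (\<P>(\<omega> in M. s \<le> Y \<omega>) - \<P>(\<omega> in M. s \<le> X \<omega>)))\<^sup>2 / L) \<partial>lborel)
    \<le> (\<integral>\<^sup>+ \<omega>. ennreal ((max 0 (Y \<omega> - X \<omega>))\<^sup>2) \<partial>M)"
proof -
  interpret lM: pair_sigma_finite lborel M ..
  define G where "G s = \<P>(\<omega> in M. s \<le> Y \<omega>)" for s
  define H where "H s = \<P>(\<omega> in M. s \<le> X \<omega>)" for s
  define J :: "real \<Rightarrow> real \<Rightarrow> 'a \<Rightarrow> ennreal"
    where "J s t \<omega> = 2 * indicator {t. 0 \<le> t \<and> X \<omega> < s \<and> s + t \<le> Y \<omega>} t" for s t \<omega>
  have lower: "ennreal ((max 0 (G s - H s))\<^sup>2 / L) \<le> (\<integral>\<^sup>+ t. \<integral>\<^sup>+ \<omega>. J s t \<omega> \<partial>M \<partial>lborel)" for s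
  proof (cases "G s \<le> H s")
    case True
    then show ?thesis by simp
  next
    case False
    define p where "p = G s - H s"
    have p: "p > 0" using False by (simp add: p_def)
    \<comment> \<open>The range of \<open>t\<close> ends at \<open>p / L\<close>, where the
      guaranteed probability \<open>p - L * t\<close> reaches 0; twice the area of the triangle
      below this line is \<open>p\<^sup>2 / L\<close>.\<close>
    have inner: "ennreal (2 * (p - L * t)) * indicator {0..p / L} t \<le> (\<integral>\<^sup>+ \<omega>. J s t \<omega> \<partial>M)" for t
    proof (cases "t \<in> {0..p / L}")
      case True
      have "p - L * t \<le> G (s + t) - H s"
        using lip[of s "s + t"] True by (simp add: p_def G_def)
      also have "\<dots> \<le> prob {\<omega> \<in> space M. X \<omega> < s \<and> s + t \<le> Y \<omega>}"
      proof -
        \<comment> \<open>Split the event that \<open>Y\<close> is at least \<open>s + t\<close> by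
          the position of \<open>X\<close>: the part with \<open>s \<le> X\<close> is charged to
          \<open>H s\<close>.\<close>
        have "G (s + t) \<le> prob ({\<omega> \<in> space M. s \<le> X \<omega>} \<union> {\<omega> \<in> space M. X \<omega> < s \<and> s + t \<le> Y \<omega>})"
          unfolding G_def by (intro finite_measure_mono) auto
        also have "\<dots> \<le> H s + prob {\<omega> \<in> space M. X \<omega> < s \<and> s + t \<le> Y \<omega>}"
          unfolding H_def by (intro measure_Un_le) auto
        finally show ?thesis by simp
      qed
      finally have "ennreal (p - L * t) \<le> emeasure M {\<omega> \<in> space M. X \<omega> < s \<and> s + t \<le> Y \<omega>}"
        by (simp add: emeasure_eq_measure ennreal_leI)
      then have "2 * ennreal (p - L * t) \<le> 2 * emeasure M {\<omega> \<in> space M. X \<omega> < s \<and> s + t \<le> Y \<omega>}"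
        by (rule mult_left_mono) simp
      also have "\<dots> = (\<integral>\<^sup>+ \<omega>. 2 * indicator {\<omega> \<in> space M. X \<omega> < s \<and> s + t \<le> Y \<omega>} \<omega> \<partial>M)"
        by (simp add: nn_integral_cmult)
      also have "\<dots> = (\<integral>\<^sup>+ \<omega>. J s t \<omega> \<partial>M)"
        using True by (intro nn_integral_cong) (auto simp: J_def indicator_def)
      finally show ?thesis using True by (simp add: ennreal_mult' del: right_diff_distrib_numeral)
    qed auto
    have "(\<integral>\<^sup>+ t. ennreal (2 * (p - L * t)) * indicator {0..p / L} t \<partial>lborel)
        = (2 * p * (p / L) - L * (p / L)\<^sup>2) - (2 * p * 0 - L * 0\<^sup>2)"
      using p \<open>0 < L\<close>
      by (intro nn_integral_FTC_Icc) (auto intro!: derivative_eq_intros simp: field_simps)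
    also have "\<dots> = p\<^sup>2 / L" using \<open>0 < L\<close> by (simp add: field_simps power2_eq_square)
    finally have "ennreal (p\<^sup>2 / L) = (\<integral>\<^sup>+ t. ennreal (2 * (p - L * t)) * indicator {0..p / L} t \<partial>lborel)"
      by simp
    also have "\<dots> \<le> (\<integral>\<^sup>+ t. \<integral>\<^sup>+ \<omega>. J s t \<omega> \<partial>M \<partial>lborel)"
      by (intro nn_integral_mono inner)
    finally show ?thesis using p by (simp add: p_def)
  qed
  have "(\<integral>\<^sup>+ s. ennreal ((max 0 (G s - H s))\<^sup>2 / L) \<partial>lborel)
      \<le> (\<integral>\<^sup>+ s. \<integral>\<^sup>+ t. \<integral>\<^sup>+ \<omega>. J s t \<omega> \<partial>M \<partial>lborel \<partial>lborel)"
    by (intro nn_integral_mono lower)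
  \<comment> \<open>The expectation moves outwards past \<open>t\<close> first, with
    \<open>s\<close> fixed, and then past \<open>s\<close>.\<close>
  also have "\<dots> = (\<integral>\<^sup>+ s. \<integral>\<^sup>+ \<omega>. \<integral>\<^sup>+ t. J s t \<omega> \<partial>lborel \<partial>M \<partial>lborel)"
    by (intro nn_integral_cong lM.Fubini'[symmetric]) (unfold J_def, measurable)
  also have "\<dots> = (\<integral>\<^sup>+ \<omega>. \<integral>\<^sup>+ s. \<integral>\<^sup>+ t. J s t \<omega> \<partial>lborel \<partial>lborel \<partial>M)"
    by (intro lM.Fubini'[symmetric]) (unfold J_def, measurable)
  also have "\<dots> \<le> (\<integral>\<^sup>+ \<omega>. ennreal ((max 0 (Y \<omega> - X \<omega>))\<^sup>2) \<partial>M)"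
    unfolding J_def by (intro nn_integral_mono nn_integral_square_layers_le)
  finally show ?thesis unfolding G_def H_def .
qed

lemma borel_measurable_prob_ge [measurable]:
  fixes X :: "'a \<Rightarrow> real"
  assumes [measurable]: "X \<in> borel_measurable M"
  shows "(\<lambda>s. \<P>(\<omega> in M. s \<le> X \<omega>)) \<in> borel_measurable borel"
proof -
  have "mono (\<lambda>s. - \<P>(\<omega> in M. s \<le> X \<omega>))"
    by (auto intro!: monoI finite_measure_mono)
  then have "(\<lambda>s. - (- \<P>(\<omega> in M. s \<le> X \<omega>))) \<in> borel_measurable borel"
    by (intro borel_measurable_uminus borel_measurable_mono)
  then show ?thesis by simp
qed

text \<open>The one-sided bound is used twice, with \<open>X\<close> and \<open>Y\<close> exchanged.
  The squares of the positive and negative parts add up to the full square on both sides.\<close>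

lemma nn_integral_tail_difference_le:
  fixes X Y :: "'a \<Rightarrow> real"
  assumes [measurable]: "X \<in> borel_measurable M" "Y \<in> borel_measurable M"
    and "0 < L"
    and "\<And>s t. s \<le> t \<Longrightarrow> \<P>(\<omega> in M. s \<le> X \<omega>) - \<P>(\<omega> in M. t \<le> X \<omega>) \<le> L * (t - s)"
    and "\<And>s t. s \<le> t \<Longrightarrow> \<P>(\<omega> in M. s \<le> Y \<omega>) - \<P>(\<omega> in M. t \<le> Y \<omega>) \<le> L * (t - s)"
  shows "(\<integral>\<^sup>+ s. ennreal ((\<P>(\<omega> in M. s \<le> X \<omega>) - \<P>(\<omega> in M. s \<le> Y \<omega>))\<^sup>2) \<partial>lborel)
    \<le> ennreal L * (\<integral>\<^sup>+ \<omega>. ennreal ((X \<omega> - Y \<omega>)\<^sup>2) \<partial>M)"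
proof -
  define D where "D s = \<P>(\<omega> in M. s \<le> X \<omega>) - \<P>(\<omega> in M. s \<le> Y \<omega>)" for s
  have [measurable]: "D \<in> borel_measurable borel" unfolding D_def by measurable
  have sq: "x\<^sup>2 = (max 0 x)\<^sup>2 + (max 0 (- x))\<^sup>2" for x :: real
    by (auto simp: max_def)
  \<comment> \<open>Taken with \<open>l = L\<close> for the tails and with \<open>l = 1\<close> for
    the cost.\<close>
  have split: "ennreal ((x - y)\<^sup>2 / l) = ennreal ((max 0 (y - x))\<^sup>2 / l) + ennreal ((max 0 (x - y))\<^sup>2 / l)"
    if "l > 0" for x y l :: real
    using sq[of "x - y"] that by (simp add: ennreal_plus[symmetric] add_divide_distrib del: ennreal_plus)
  have "(\<integral>\<^sup>+ s. ennreal ((D s)\<^sup>2 / L) \<partial>lborel) \<le> (\<integral>\<^sup>+ \<omega>. ennreal ((X \<omega> - Y \<omega>)\<^sup>2) \<partial>M)"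
    using add_mono[OF nn_integral_tail_excess_le[OF assms(1,2,3,5)]
        nn_integral_tail_excess_le[OF assms(2,1,3,4)]]
      split[OF \<open>0 < L\<close>] split[of 1]
    by (simp add: D_def nn_integral_add)
  then have "ennreal L * (\<integral>\<^sup>+ s. ennreal ((D s)\<^sup>2 / L) \<partial>lborel)
      \<le> ennreal L * (\<integral>\<^sup>+ \<omega>. ennreal ((X \<omega> - Y \<omega>)\<^sup>2) \<partial>M)"
    by (rule mult_left_mono) simp
  moreover have "ennreal L * (\<integral>\<^sup>+ s. ennreal ((D s)\<^sup>2 / L) \<partial>lborel) = (\<integral>\<^sup>+ s. ennreal ((D s)\<^sup>2) \<partial>lborel)"
    using \<open>0 < L\<close> by (subst nn_integral_cmult[symmetric]) (simp_all add: ennreal_mult[symmetric])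
  ultimately show ?thesis by (simp add: D_def)
qed

section \<open>Moments in terms of tail functions\<close>

text \<open>Write \<open>\<phi> (X \<omega>) - \<phi> c\<close> as the integral of
  \<open>\<phi>'\<close> from \<open>c\<close> to \<open>X \<omega>\<close> and exchange it with the
  expectation.\<close>

lemma expectation_eq_integral_tail:
  fixes X :: "'a \<Rightarrow> real" and \<phi> \<phi>' :: "real \<Rightarrow> real"
  assumes [measurable]: "X \<in> borel_measurable M"
    and X: "X \<in> space M \<rightarrow> {c..d}"
    and deriv: "\<And>s. DERIV \<phi> s :> \<phi>' s" and cont: "continuous_on UNIV \<phi>'"
  shows "expectation (\<lambda>\<omega>. \<phi> (X \<omega>)) = \<phi> c + (\<integral>s. indicator {c..d} s * \<phi>' s * \<P>(\<omega> in M. s \<le> X \<omega>) \<partial>lborel)"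
    and "integrable lborel (\<lambda>s. indicator {c..d} s * \<phi>' s * \<P>(\<omega> in M. s \<le> X \<omega>))"
proof -
  interpret lM: pair_sigma_finite lborel M ..
  have [measurable]: "\<phi>' \<in> borel_measurable borel"
    using cont by (rule borel_measurable_continuous_onI)
  define J where "J s \<omega> = indicator {c..d} s * \<phi>' s * indicator {\<omega>. s \<le> X \<omega>} \<omega>" for s \<omega>
  have J_meas [measurable]: "case_prod J \<in> borel_measurable (lborel \<Otimes>\<^sub>M M)"
    unfolding J_def by measurable
  have "bounded (\<phi>' ` {c..d})"
    by (intro compact_imp_bounded compact_continuous_image continuous_on_subset[OF cont]) auto
  then obtain C where C: "\<And>s. s \<in> {c..d} \<Longrightarrow> \<bar>\<phi>' s\<bar> \<le> C"
    unfolding bounded_iff by (metis imageI real_norm_def)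
  have J_le: "\<bar>J s \<omega>\<bar> \<le> \<bar>\<phi>' s\<bar>" for s \<omega>
    by (simp add: J_def indicator_def)
  \<comment> \<open>As \<open>\<phi>'\<close> may change sign, the exchange needs integrability:
    \<open>J\<close> is bounded on a set of finite product measure and vanishes off it.\<close>
  have int: "integrable (lborel \<Otimes>\<^sub>M M) (case_prod J)"
  proof (rule integrableI_bounded_set[where A = "{c..d} \<times> space M" and B = C])
    show "emeasure (lborel \<Otimes>\<^sub>M M) ({c..d} \<times> space M) < \<infinity>"
      by (cases "c \<le> d") (auto simp: emeasure_pair_measure_Times emeasure_space_1)
    show "AE x\<in>{c..d} \<times> space M in lborel \<Otimes>\<^sub>M M. norm (case_prod J x) \<le> C"
    proof (intro AE_I2 impI)
      fix x :: "real \<times> 'a" assume "x \<in> {c..d} \<times> space M"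
      then show "norm (case_prod J x) \<le> C"
        using order_trans[OF J_le C[of "fst x"]] by (auto simp: case_prod_beta)
    qed
    show "AE x in lborel \<Otimes>\<^sub>M M. x \<notin> {c..d} \<times> space M \<longrightarrow> case_prod J x = 0"
      by (rule AE_I2) (auto simp: J_def space_pair_measure split: split_indicator_asm)
  qed auto
  have inner: "(\<integral>\<omega>. J s \<omega> \<partial>M) = indicator {c..d} s * \<phi>' s * \<P>(\<omega> in M. s \<le> X \<omega>)" for s
  proof -
    have "(\<integral>\<omega>. indicator {\<omega>. s \<le> X \<omega>} \<omega> \<partial>M) = (\<integral>\<omega>. indicator {\<omega> \<in> space M. s \<le> X \<omega>} \<omega> \<partial>M :: real)"
      by (intro Bochner_Integration.integral_cong) (auto simp: indicator_def)
    then show ?thesis by (simp add: J_def)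
  qed
  have "(\<integral>s. J s \<omega> \<partial>lborel) = \<phi> (X \<omega>) - \<phi> c" if "\<omega> \<in> space M" for \<omega>
  proof -
    have "(\<integral>s. J s \<omega> \<partial>lborel) = (\<integral>s. indicator {c..X \<omega>} s *\<^sub>R \<phi>' s \<partial>lborel)"
      using funcset_mem[OF X that] by (intro Bochner_Integration.integral_cong) (auto simp: J_def indicator_def)
    also have "\<dots> = \<phi> (X \<omega>) - \<phi> c"
      using funcset_mem[OF X that] deriv
      by (intro integral_FTC_atLeastAtMost continuous_on_subset[OF cont])
        (auto simp: has_real_derivative_iff_has_vector_derivative[symmetric]
          intro: has_field_derivative_at_within)
    finally show ?thesis .
  qed
  then have "expectation (\<lambda>\<omega>. \<phi> (X \<omega>)) = expectation (\<lambda>\<omega>. \<phi> c + (\<integral>s. J s \<omega> \<partial>lborel))"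
    by (intro Bochner_Integration.integral_cong) auto
  also have "\<dots> = \<phi> c + expectation (\<lambda>\<omega>. \<integral>s. J s \<omega> \<partial>lborel)"
    using lM.integrable_snd[OF int] by (simp add: prob_space)
  also have "expectation (\<lambda>\<omega>. \<integral>s. J s \<omega> \<partial>lborel) = (\<integral>s. (\<integral>\<omega>. J s \<omega> \<partial>M) \<partial>lborel)"
    by (rule lM.Fubini_integral[OF int])
  finally show "expectation (\<lambda>\<omega>. \<phi> (X \<omega>)) = \<phi> c + (\<integral>s. indicator {c..d} s * \<phi>' s * \<P>(\<omega> in M. s \<le> X \<omega>) \<partial>lborel)"
    by (simp add: inner)
  show "integrable lborel (\<lambda>s. indicator {c..d} s * \<phi>' s * \<P>(\<omega> in M. s \<le> X \<omega>))"
    using lM.integrable_fst[OF int] by (simp add: inner)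
qed

text \<open>With \<open>\<phi> s = s ^ k\<close> the constants \<open>\<phi> c\<close> cancel,
  leaving the tail difference weighted by \<open>k * s ^ (k - 1)\<close>. The prefactor is the
  integral of the squared weight in Cauchy-Schwarz.\<close>

lemma moment_difference_le_tail_difference:
  fixes X Y :: "'a \<Rightarrow> real"
  assumes [measurable]: "X \<in> borel_measurable M" "Y \<in> borel_measurable M"
    and X: "X \<in> space M \<rightarrow> {c..d}"
    and Y: "Y \<in> space M \<rightarrow> {c..d}"
    and "c \<le> d" "1 \<le> k"
  shows "ennreal ((expectation (\<lambda>\<omega>. X \<omega> ^ k) - expectation (\<lambda>\<omega>. Y \<omega> ^ k))\<^sup>2)
    \<le> ennreal ((real k)\<^sup>2 * (d ^ (2 * k - 1) - c ^ (2 * k - 1)) / (2 * real k - 1))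
      * (\<integral>\<^sup>+ s. ennreal ((\<P>(\<omega> in M. s \<le> X \<omega>) - \<P>(\<omega> in M. s \<le> Y \<omega>))\<^sup>2) \<partial>lborel)"
proof -
  define D where "D s = \<P>(\<omega> in M. s \<le> X \<omega>) - \<P>(\<omega> in M. s \<le> Y \<omega>)" for s
  define p where "p s = indicator {c..d} s * (real k * s ^ (k - 1))" for s :: real
  have [measurable]: "D \<in> borel_measurable borel" "p \<in> borel_measurable borel"
    unfolding D_def p_def by measurable
  have deriv: "DERIV (\<lambda>s. s ^ k) s :> real k * s ^ (k - 1)" for s :: real
    using DERIV_pow[of k s] by simp
  have cont: "continuous_on UNIV (\<lambda>s::real. real k * s ^ (k - 1))"
    by (intro continuous_intros)
  note tX = expectation_eq_integral_tail[OF assms(1) X deriv cont]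
  note tY = expectation_eq_integral_tail[OF assms(2) Y deriv cont]
  have pD: "(\<lambda>s. p s * D s) =
      (\<lambda>s. indicator {c..d} s * (real k * s ^ (k - 1)) * \<P>(\<omega> in M. s \<le> X \<omega>)
        - indicator {c..d} s * (real k * s ^ (k - 1)) * \<P>(\<omega> in M. s \<le> Y \<omega>))"
    by (simp add: p_def D_def algebra_simps)
  have diff: "expectation (\<lambda>\<omega>. X \<omega> ^ k) - expectation (\<lambda>\<omega>. Y \<omega> ^ k) = (\<integral>s. p s * D s \<partial>lborel)"
    unfolding pD Bochner_Integration.integral_diff[OF tX(2) tY(2)] tX(1) tY(1) by simp
  have "integrable lborel (\<lambda>s. p s * D s)"
    unfolding pD by (rule Bochner_Integration.integrable_diff[OF tX(2) tY(2)])
  then have "ennreal \<bar>\<integral>s. p s * D s \<partial>lborel\<bar> \<le> (\<integral>\<^sup>+ s. ennreal \<bar>p s\<bar> * ennreal \<bar>D s\<bar> \<partial>lborel)"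
    using integral_norm_bound_ennreal[of lborel "\<lambda>s. p s * D s"] by (simp add: abs_mult ennreal_mult)
  then have "(ennreal \<bar>\<integral>s. p s * D s \<partial>lborel\<bar>)\<^sup>2 \<le> (\<integral>\<^sup>+ s. ennreal \<bar>p s\<bar> * ennreal \<bar>D s\<bar> \<partial>lborel)\<^sup>2"
    by (rule power_mono) simp
  also have "\<dots> \<le> (\<integral>\<^sup>+ s. (ennreal \<bar>p s\<bar>)\<^sup>2 \<partial>lborel) * (\<integral>\<^sup>+ s. (ennreal \<bar>D s\<bar>)\<^sup>2 \<partial>lborel)"
    by (rule Cauchy_Schwarz_nn_integral) measurable
  also have "(\<integral>\<^sup>+ s. (ennreal \<bar>p s\<bar>)\<^sup>2 \<partial>lborel)
      = (\<integral>\<^sup>+ s. ennreal ((real k)\<^sup>2 * s ^ (2 * k - 2)) * indicator {c..d} s \<partial>lborel)"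
  proof (rule nn_integral_cong)
    have "(2 * k - 2) = (k - 1) * 2" by simp
    then show "(ennreal \<bar>p s\<bar>)\<^sup>2 = ennreal ((real k)\<^sup>2 * s ^ (2 * k - 2)) * indicator {c..d} s" for s
      by (simp add: p_def indicator_def ennreal_power power_mult_distrib power_mult)
  qed
  also have "\<dots> = ennreal ((real k)\<^sup>2 * d ^ (2 * k - 1) / (2 * real k - 1)
      - (real k)\<^sup>2 * c ^ (2 * k - 1) / (2 * real k - 1))"
  proof (rule nn_integral_FTC_Icc)
    fix s :: real
    have "2 * k - 1 - 1 = 2 * k - 2" "real (2 * k - 1) = 2 * real k - 1"
      using \<open>1 \<le> k\<close> by (auto simp: of_nat_diff)
    then have *: "DERIV (\<lambda>s. s ^ (2 * k - 1)) s :> (2 * real k - 1) * s ^ (2 * k - 2)"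
      using DERIV_pow[of "2 * k - 1" s] by simp
    show "DERIV (\<lambda>s. (real k)\<^sup>2 * s ^ (2 * k - 1) / (2 * real k - 1)) s :> (real k)\<^sup>2 * s ^ (2 * k - 2)"
      using DERIV_cdivide[OF DERIV_cmult[OF *, of "(real k)\<^sup>2"], of "2 * real k - 1"] \<open>1 \<le> k\<close>
      by (simp add: mult.left_commute)
    have "(2 * k - 2) = 2 * (k - 1)" by simp
    then show "0 \<le> (real k)\<^sup>2 * s ^ (2 * k - 2)" by (simp add: power_mult)
  qed (use \<open>c \<le> d\<close> in auto)
  finally show ?thesis
    by (simp add: diff D_def ennreal_power diff_divide_distrib right_diff_distrib)
qed

end

section \<open>Lipschitz tails under the weighted measure\<close>

lemma space_weighted_measure [simp]: "space (weighted_measure {a..b} r) = {a..b}"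
  by (simp add: weighted_measure_def space_restrict_space)

lemma sets_weighted_measure [measurable_cong]:
  "sets (weighted_measure I r) = sets (restrict_space borel I)"
  by (simp add: weighted_measure_def cong: sets_restrict_space_cong)

lemma borel_measurable_weighted_measure:
  fixes f :: "real \<Rightarrow> real"
  assumes "continuous_on I f"
  shows "f \<in> borel_measurable (weighted_measure I r)"
  using borel_measurable_continuous_on_restrict[OF assms]
  by (simp add: measurable_cong_sets[OF sets_weighted_measure refl])

lemma emeasure_weighted_measure_le:
  assumes "continuous_on {a..b} r" "\<And>x. x \<in> {a..b} \<Longrightarrow> r x \<le> R"
    and "E \<subseteq> {a..b}" "E \<in> sets borel"
  shows "emeasure (weighted_measure {a..b} r) E \<le> ennreal R * emeasure lborel E"
proof -
  have r: "(\<lambda>x. ennreal (r x)) \<in> borel_measurable (restrict_space lborel {a..b})"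
    using borel_measurable_continuous_on_restrict[OF assms(1)]
    by (intro measurable_compose[OF _ measurable_ennreal])
      (simp add: measurable_cong_sets[OF sets_restrict_space_cong[OF sets_lborel] refl])
  have E: "E \<in> sets (restrict_space lborel {a..b})"
    using assms(3,4) by (simp add: sets_restrict_space_iff)
  have "emeasure (weighted_measure {a..b} r) E
      = (\<integral>\<^sup>+ x. ennreal (r x) * indicator E x \<partial>restrict_space lborel {a..b})"
    unfolding weighted_measure_def by (rule emeasure_density[OF r E])
  also have "\<dots> \<le> (\<integral>\<^sup>+ x. ennreal R * indicator E x \<partial>restrict_space lborel {a..b})"
    using assms(2) by (intro nn_integral_mono mult_right_mono ennreal_leI)
      (auto simp: space_restrict_space)
  also have "\<dots> = ennreal R * emeasure lborel E"
    using E assms(3) by (simp add: nn_integral_cmult_indicator emeasure_restrict_space)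
  finally show ?thesis .
qed

text \<open>The tails of \<open>f\<close> and \<open>fs\<close> coincide, so the estimate is made
  for \<open>fs\<close>: the points with values in \<open>[s, t)\<close> fit into an interval of
  length \<open>(t - s) / \<tau>\<close>, and the density is at most \<open>R\<close>.\<close>

lemma tail_lipschitz:
  fixes a b R \<tau> :: real and r f fs :: "real \<Rightarrow> real"
  defines "\<rho> \<equiv> weighted_measure {a..b} r"
  assumes r: "continuous_on {a..b} r" "\<And>x. x \<in> {a..b} \<Longrightarrow> r x \<le> R" and "0 \<le> R"
    and "prob_space \<rho>" and fs: "decreasing_rearrangement \<rho> f fs" and "0 < \<tau>"
    and deriv: "\<And>x D. x \<in> {a..b} \<Longrightarrow> (fs has_real_derivative D) (at x within {a..b}) \<Longrightarrow> \<bar>D\<bar> > \<tau>"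
    and "s \<le> t"
  shows "\<P>(x in \<rho>. s \<le> f x) - \<P>(x in \<rho>. t \<le> f x) \<le> R / \<tau> * (t - s)"
proof -
  interpret prob_space \<rho> by fact
  have sp [simp]: "space \<rho> = {a..b}" by (simp add: \<rho>_def)
  have "a \<le> b" using not_empty by simp
  have anti: "fs y \<le> fs x" if "a \<le> x" "x \<le> y" "y \<le> b" for x y
    using fs that by (auto simp: decreasing_rearrangement_def monotone_on_def)
  \<comment> \<open>Clamping the argument extends \<open>- fs\<close> from \<open>{a..b}\<close> to
    a monotone function on the whole line, as the slope bound and Borel measurability
    require.\<close>
  define u where "u x = - fs (max a (min b x))" for x
  have u: "u x = - fs x" if "x \<in> {a..b}" for x using that by (simp add: u_def)
  have "mono u" using \<open>a \<le> b\<close> by (intro monoI) (auto simp: u_def intro!: anti)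
  have [measurable]: "u \<in> borel_measurable borel" using \<open>mono u\<close> by (rule borel_measurable_mono)
  have u_deriv: "\<tau> \<le> D" if x: "a < x" "x < b" and D: "DERIV u x :> D" for x D
  proof -
    have "DERIV (\<lambda>x. - u x) x :> - D" using D by (rule DERIV_minus)
    then have "DERIV fs x :> - D"
      by (rule has_field_derivative_transform_within_open[of _ _ _ "{a<..<b}"]) (use x u in auto)
    then have "\<bar>- D\<bar> > \<tau>"
      using deriv[of x "- D", OF _ has_field_derivative_at_within] x by simp
    \<comment> \<open>The hypothesis controls only the absolute value; monotonicity supplies the
      sign.\<close>
    moreover have "0 \<le> D"
      using mono_on_imp_deriv_nonneg[of UNIV u D x] \<open>mono u\<close> D by simp
    ultimately show ?thesis by simp
  qed
  have gap: "\<tau> * (y - x) \<le> fs x - fs y" if "a \<le> x" "x \<le> y" "y \<le> b" for x y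
    using expanding_if_deriv_ge[OF \<open>mono u\<close> _ u_deriv that] u[of x] u[of y] that \<open>0 < \<tau>\<close> by auto
  have superlevel: "{x \<in> {a..b}. z \<le> fs x} = {a..b} \<inter> {x. u x \<le> - z}" for z
    using u by auto
  have sl_meas: "{x \<in> {a..b}. z \<le> fs x} \<in> events" for z
    unfolding superlevel \<rho>_def sets_weighted_measure by (auto simp: sets_restrict_space_iff)
  define E where "E = {x \<in> {a..b}. s \<le> fs x} - {x \<in> {a..b}. t \<le> fs x}"
  have E: "E \<subseteq> {a..b}" "E \<in> sets borel"
    unfolding E_def superlevel by (auto, measurable)
  have "\<P>(x in \<rho>. s \<le> f x) - \<P>(x in \<rho>. t \<le> f x) = prob {x \<in> {a..b}. s \<le> fs x} - prob {x \<in> {a..b}. t \<le> fs x}"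
    using fs by (simp add: decreasing_rearrangement_def)
  also have "\<dots> = prob E"
    unfolding E_def using \<open>s \<le> t\<close> sl_meas by (intro finite_measure_Diff[symmetric]) auto
  also have "ennreal (prob E) \<le> ennreal (R / \<tau> * (t - s))"
  proof (cases "E = {}")
    case False
    have bdd: "bdd_below E" using E(1) by (rule bdd_below_mono[rotated]) simp
    \<comment> \<open>Any two points of \<open>E\<close> are at most \<open>(t - s) / \<tau>\<close>
      apart, so \<open>E\<close> fits into an interval of that length starting at its
      infimum.\<close>
    have "x \<le> Inf E + (t - s) / \<tau>" if "x \<in> E" for x
    proof -
      have "x - (t - s) / \<tau> \<le> y" if "y \<in> E" for y
      proof (cases "y \<le> x")
        case True
        have "\<tau> * (x - y) \<le> t - s" using gap[of y x] True that \<open>x \<in> E\<close> by (auto simp: E_def)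
        then show ?thesis using \<open>0 < \<tau>\<close> by (simp add: field_simps)
      next
        case False
        then show ?thesis using \<open>s \<le> t\<close> \<open>0 < \<tau>\<close> by (smt (verit) divide_nonneg_pos)
      qed
      then have "x - (t - s) / \<tau> \<le> Inf E" by (intro cInf_greatest False)
      then show ?thesis by simp
    qed
    then have "E \<subseteq> {Inf E..Inf E + (t - s) / \<tau>}" using cInf_lower[OF _ bdd] by auto
    then have "emeasure lborel E \<le> emeasure lborel {Inf E..Inf E + (t - s) / \<tau>}"
      by (intro emeasure_mono) auto
    also have "\<dots> = ennreal ((t - s) / \<tau>)" using \<open>s \<le> t\<close> \<open>0 < \<tau>\<close> by simp
    finally have "ennreal R * emeasure lborel E \<le> ennreal R * ennreal ((t - s) / \<tau>)"
      by (rule mult_left_mono) simp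
    then show ?thesis
      using order_trans[OF emeasure_weighted_measure_le[OF r E]] \<open>0 \<le> R\<close> \<open>s \<le> t\<close> \<open>0 < \<tau>\<close>
      by (simp add: emeasure_eq_measure[symmetric] \<rho>_def[symmetric] ennreal_mult'[symmetric])
  qed simp
  finally show ?thesis using \<open>0 \<le> R\<close> \<open>s \<le> t\<close> \<open>0 < \<tau>\<close> by simp
qed

section \<open>The lower bound for the Wasserstein distance\<close>

text \<open>A coupling of finite cost is needed because \<open>enn2real \<infinity> = 0\<close>.\<close>

lemma le_W2I:
  assumes "\<gamma>\<^sub>0 \<in> couplings \<mu> \<nu>"
    and fin: "(\<integral>\<^sup>+ (x, y). ennreal (\<bar>x - y\<bar>\<^sup>2) \<partial>\<gamma>\<^sub>0) < \<infinity>" and "0 \<le> c"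
    and le: "\<And>\<gamma>. \<gamma> \<in> couplings \<mu> \<nu> \<Longrightarrow> ennreal (c\<^sup>2) \<le> (\<integral>\<^sup>+ (x, y). ennreal (\<bar>x - y\<bar>\<^sup>2) \<partial>\<gamma>)"
  shows "c \<le> W2 \<mu> \<nu>"
proof -
  let ?I = "INF \<gamma>\<in>couplings \<mu> \<nu>. \<integral>\<^sup>+ (x, y). ennreal (\<bar>x - y\<bar>\<^sup>2) \<partial>\<gamma>"
  have "?I < top" using fin by (intro le_less_trans[OF INF_lower[OF assms(1)]]) simp
  moreover have "ennreal (c\<^sup>2) \<le> ?I" by (intro INF_greatest le)
  ultimately have "c\<^sup>2 \<le> enn2real ?I" using enn2real_mono by fastforce
  then show ?thesis unfolding W2_def by (rule real_le_rsqrt)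
qed

theorem theorem5:
  fixes a b \<tau> M m R A :: real
    and r f g fs gs :: "real \<Rightarrow> real"
    and \<rho> \<mu> \<nu> :: "real measure"
    and k :: nat
  defines "\<rho> \<equiv> weighted_measure {a..b} r"
    and "\<mu> \<equiv> distr \<rho> borel f"
    and "\<nu> \<equiv> distr \<rho> borel g"
    and "M \<equiv> (SUP x\<in>{a..b}. max (f x) (g x))"
    and "m \<equiv> (INF x\<in>{a..b}. min (f x) (g x))"
    and "R \<equiv> (SUP x\<in>{a..b}. \<bar>r x\<bar>)"
    and "A \<equiv> sqrt (2 * real k - 1) / real k * (M ^ (2 * k - 1) - m ^ (2 * k - 1)) powr (- 1 / 2)
               * \<tau> powr (1 / 2) * R powr (- 1 / 2)"
  assumes "a < b"
    and "continuous_on {a..b} r" and "bounded (r ` {a..b})" and "\<And>x. x \<in> {a..b} \<Longrightarrow> 0 \<le> r x"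
    and "prob_space \<rho>"
    and "C1_on {a..b} f" and "C1_on {a..b} g"
    and "decreasing_rearrangement \<rho> f fs" and "decreasing_rearrangement \<rho> g gs"
    and "0 < \<tau>"
    and "\<And>x D. x \<in> {a..b} \<Longrightarrow> (fs has_real_derivative D) (at x within {a..b}) \<Longrightarrow> \<bar>D\<bar> > \<tau>"
    and "\<And>x D. x \<in> {a..b} \<Longrightarrow> (gs has_real_derivative D) (at x within {a..b}) \<Longrightarrow> \<bar>D\<bar> > \<tau>"
    and "1 \<le> k"
  shows "0 < A \<and>
         W2 \<mu> \<nu> \<ge> A * \<bar>(\<integral>x. f x ^ k \<partial>\<rho>) - (\<integral>x. g x ^ k \<partial>\<rho>)\<bar>"
proof -
  let ?L = "R / \<tau>"
  interpret prob_space \<rho> by fact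
  have sp [simp]: "space \<rho> = {a..b}" by (simp add: \<rho>_def)
  have C1_cont: "continuous_on {a..b} h" if "C1_on {a..b} h" for h
    using that unfolding C1_on_def by (blast intro: DERIV_continuous_on)
  have cont: "continuous_on {a..b} f" "continuous_on {a..b} g"
    by (fact C1_cont[OF \<open>C1_on {a..b} f\<close>] C1_cont[OF \<open>C1_on {a..b} g\<close>])+
  have [measurable]: "f \<in> borel_measurable \<rho>" "g \<in> borel_measurable \<rho>"
    unfolding \<rho>_def by (intro borel_measurable_weighted_measure cont)+
  have bdd: "bdd_above ((\<lambda>x. max (f x) (g x)) ` {a..b})" "bdd_below ((\<lambda>x. min (f x) (g x)) ` {a..b})"
    by (intro bounded_imp_bdd_above bounded_imp_bdd_below compact_imp_bounded
      compact_continuous_image continuous_intros cont compact_Icc)+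
  have upper: "f x \<le> M" "g x \<le> M" if "x \<in> {a..b}" for x
    using cSUP_upper[OF that bdd(1)] by (auto simp: M_def)
  have lower: "m \<le> f x" "m \<le> g x" if "x \<in> {a..b}" for x
    using cINF_lower[OF bdd(2) that] by (auto simp: m_def)
  have range: "f \<in> space \<rho> \<rightarrow> {m..M}" "g \<in> space \<rho> \<rightarrow> {m..M}"
    using upper lower by auto
  have r_le: "r x \<le> R" if "x \<in> {a..b}" for x
  proof -
    have "bdd_above ((\<lambda>x. \<bar>r x\<bar>) ` {a..b})"
      by (intro bounded_imp_bdd_above compact_imp_bounded compact_continuous_image
        continuous_intros assms compact_Icc)
    then have "\<bar>r x\<bar> \<le> R" unfolding R_def by (intro cSUP_upper that)
    then show ?thesis by simp
  qed
  have "0 \<le> R" using r_le[of a] assms(11)[of a] \<open>a < b\<close> by force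
  have lip_f: "\<P>(x in \<rho>. s \<le> f x) - \<P>(x in \<rho>. t \<le> f x) \<le> ?L * (t - s)" if "s \<le> t" for s t
    using tail_lipschitz[of a b r R f fs \<tau> s t] assms r_le \<open>0 \<le> R\<close> that by (simp add: \<rho>_def)
  have lip_g: "\<P>(x in \<rho>. s \<le> g x) - \<P>(x in \<rho>. t \<le> g x) \<le> ?L * (t - s)" if "s \<le> t" for s t
    using tail_lipschitz[of a b r R g gs \<tau> s t] assms r_le \<open>0 \<le> R\<close> that by (simp add: \<rho>_def)
  have "m \<le> M" using lower[of a] upper[of a] \<open>a < b\<close> by force
  \<comment> \<open>The tail of \<open>f\<close> falls from 1 at \<open>m\<close> to 0 beyond
    \<open>M\<close>, so its Lipschitz constant cannot be too small. This excludes both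
    \<open>R = 0\<close> and \<open>m = M\<close>, which makes \<open>A\<close> positive.\<close>
  have steep: "1 \<le> ?L * (t - m)" if "M < t" for t
  proof -
    have one: "{x \<in> space \<rho>. m \<le> f x} = space \<rho>" using lower by auto
    have zero: "{x \<in> space \<rho>. t \<le> f x} = {}" using upper that by fastforce
    show ?thesis using lip_f[of m t, unfolded one zero prob_space] that \<open>m \<le> M\<close> by simp
  qed
  have "R \<noteq> 0" using steep[of "M + 1"] by auto
  with \<open>0 \<le> R\<close> have "0 < R" by simp
  with \<open>0 < \<tau>\<close> have L: "0 < ?L" by simp
  have "m < M"
  proof (rule ccontr)
    assume "\<not> m < M"
    then have "M = m" using \<open>m \<le> M\<close> by simp
    \<comment> \<open>At this distance above \<open>m\<close> the tail could have dropped by at most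
      1/2.\<close>
    then show False using steep[of "m + 1 / (2 * ?L)"] \<open>0 < R\<close> \<open>0 < \<tau>\<close> by (simp add: field_simps)
  qed
  \<comment> \<open>\<open>m\<close> may be negative; the odd exponent makes the power monotone and
    injective on all reals.\<close>
  have "m ^ (2 * k - 1) < M ^ (2 * k - 1)"
  proof -
    have "odd (2 * k - 1)" using \<open>1 \<le> k\<close> by simp
    then have "m ^ (2 * k - 1) \<le> M ^ (2 * k - 1)" "m ^ (2 * k - 1) \<noteq> M ^ (2 * k - 1)"
      using \<open>m < M\<close> power_mono_odd[of "2 * k - 1" m M] odd_real_root_power_cancel
      by (force, metis less_irrefl)
    then show ?thesis by simp
  qed
  define D where "D = M ^ (2 * k - 1) - m ^ (2 * k - 1)"
  have D: "0 < D" using \<open>m ^ (2 * k - 1) < M ^ (2 * k - 1)\<close> by (simp add: D_def)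
  define C where "C = (real k)\<^sup>2 * D / (2 * real k - 1)"
  have C: "0 < C" using D \<open>1 \<le> k\<close> by (simp add: C_def)
  have "A = sqrt (2 * real k - 1) / real k * (1 / sqrt D) * sqrt \<tau> * (1 / sqrt R)"
    unfolding A_def D_def[symmetric]
    using D \<open>0 < R\<close> \<open>0 < \<tau>\<close> by (simp add: powr_half_sqrt powr_minus_divide)
  \<comment> \<open>\<open>C\<close> comes from Cauchy-Schwarz and \<open>?L\<close> from the
    coupling estimate; \<open>A\<close> is the positive number whose square cancels their
    product.\<close>
  then have A2: "A\<^sup>2 = 1 / (C * ?L)" and "0 < A"
    using D \<open>0 < R\<close> \<open>0 < \<tau>\<close> \<open>1 \<le> k\<close>
    by (simp_all add: C_def power_mult_distrib power_divide)
  let ?\<Delta> = "(\<integral>x. f x ^ k \<partial>\<rho>) - (\<integral>x. g x ^ k \<partial>\<rho>)"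
  have coupling_bound: "ennreal ((A * \<bar>?\<Delta>\<bar>)\<^sup>2) \<le> (\<integral>\<^sup>+ (x, y). ennreal (\<bar>x - y\<bar>\<^sup>2) \<partial>\<gamma>)"
    if "\<gamma> \<in> couplings \<mu> \<nu>" for \<gamma>
  proof -
    have \<gamma>: "sets \<gamma> = sets borel" "distr \<gamma> borel fst = \<mu>" "distr \<gamma> borel snd = \<nu>"
      using that by (auto simp: couplings_def)
    have [measurable_cong]: "sets \<gamma> = sets (borel \<Otimes>\<^sub>M borel :: (real \<times> real) measure)"
      unfolding borel_prod by (rule \<gamma>(1))
    have sp\<gamma>: "space \<gamma> = UNIV" using sets_eq_imp_space_eq[OF \<gamma>(1)] by simp
    have tail_fst: "\<P>(p in \<gamma>. s \<le> fst p) = \<P>(x in \<rho>. s \<le> f x)" for s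
    proof -
      have "measure (distr \<gamma> borel fst) {s..} = measure (distr \<rho> borel f) {s..}"
        by (simp add: \<gamma> \<mu>_def)
      then show ?thesis by (simp add: measure_distr vimage_def Int_def conj_commute)
    qed
    have tail_snd: "\<P>(p in \<gamma>. s \<le> snd p) = \<P>(x in \<rho>. s \<le> g x)" for s
    proof -
      have "measure (distr \<gamma> borel snd) {s..} = measure (distr \<rho> borel g) {s..}"
        by (simp add: \<gamma> \<nu>_def)
      then show ?thesis by (simp add: measure_distr vimage_def Int_def conj_commute)
    qed
    have "prob_space (distr \<gamma> borel fst)" unfolding \<gamma> \<mu>_def by (rule prob_space_distr) simp
    then interpret \<gamma>: prob_space \<gamma> by (rule prob_space_distrD[rotated]) simp
    have "ennreal (?\<Delta>\<^sup>2) \<le> ennreal C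
        * (\<integral>\<^sup>+ s. ennreal ((\<P>(x in \<rho>. s \<le> f x) - \<P>(x in \<rho>. s \<le> g x))\<^sup>2) \<partial>lborel)"
      using moment_difference_le_tail_difference[OF _ _ range] \<open>m \<le> M\<close> \<open>1 \<le> k\<close>
      by (simp add: C_def D_def)
    also have "\<dots> \<le> ennreal C * (ennreal ?L * (\<integral>\<^sup>+ p. ennreal ((fst p - snd p)\<^sup>2) \<partial>\<gamma>))"
      unfolding tail_fst[symmetric] tail_snd[symmetric] using L lip_f lip_g
      by (intro mult_left_mono \<gamma>.nn_integral_tail_difference_le) (simp_all only: tail_fst tail_snd, measurable)
    finally have "ennreal (A\<^sup>2) * ennreal (?\<Delta>\<^sup>2)
        \<le> ennreal (A\<^sup>2) * (ennreal C * (ennreal ?L * (\<integral>\<^sup>+ p. ennreal ((fst p - snd p)\<^sup>2) \<partial>\<gamma>)))"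
      by (rule mult_left_mono) simp
    also have "\<dots> = (\<integral>\<^sup>+ p. ennreal ((fst p - snd p)\<^sup>2) \<partial>\<gamma>)"
    proof -
      have "ennreal (A\<^sup>2) * (ennreal C * ennreal ?L) = ennreal (A\<^sup>2 * (C * ?L))"
        using C L by (simp only: ennreal_mult zero_le_power2 mult_nonneg_nonneg less_imp_le)
      also have "A\<^sup>2 * (C * ?L) = 1"
        using mult_pos_pos[OF C L] unfolding A2 by (metis less_irrefl nonzero_divide_eq_eq)
      finally show ?thesis by (simp only: mult.assoc[symmetric]) simp
    qed
    finally show ?thesis
      by (simp add: power_mult_distrib ennreal_mult case_prod_unfold)
  qed
  \<comment> \<open>The joint law of \<open>f\<close> and \<open>g\<close> serves as the coupling of
    finite cost, at most \<open>(M - m)\<^sup>2\<close>.\<close>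
  define \<gamma>\<^sub>0 where "\<gamma>\<^sub>0 = distr \<rho> borel (\<lambda>x. (f x, g x))"
  have [measurable]: "(\<lambda>x. (f x, g x)) \<in> \<rho> \<rightarrow>\<^sub>M borel"
    unfolding borel_prod[symmetric] by measurable
  have [measurable]: "(fst :: real \<times> real \<Rightarrow> real) \<in> borel_measurable borel"
    "(snd :: real \<times> real \<Rightarrow> real) \<in> borel_measurable borel"
    by (intro borel_measurable_continuous_onI continuous_intros)+
  have "\<gamma>\<^sub>0 \<in> couplings \<mu> \<nu>"
    by (simp add: couplings_def \<gamma>\<^sub>0_def \<mu>_def \<nu>_def distr_distr comp_def)
  moreover have "(\<integral>\<^sup>+ (x, y). ennreal (\<bar>x - y\<bar>\<^sup>2) \<partial>\<gamma>\<^sub>0) < \<infinity>"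
  proof -
    have "(\<integral>\<^sup>+ (x, y). ennreal (\<bar>x - y\<bar>\<^sup>2) \<partial>\<gamma>\<^sub>0) = (\<integral>\<^sup>+ x. ennreal (\<bar>f x - g x\<bar>\<^sup>2) \<partial>\<rho>)"
      unfolding \<gamma>\<^sub>0_def by (subst nn_integral_distr) (auto simp: borel_prod[symmetric])
    also have "\<dots> \<le> (\<integral>\<^sup>+ x. ennreal ((M - m)\<^sup>2) \<partial>\<rho>)"
    proof (intro nn_integral_mono ennreal_leI power_mono)
      show "\<bar>f x - g x\<bar> \<le> M - m" if "x \<in> space \<rho>" for x
        using upper[of x] lower[of x] that by auto
    qed simp
    also have "\<dots> < \<infinity>" by (simp add: ennreal_mult_less_top emeasure_eq_measure)
    finally show ?thesis .
  qed
  ultimately have "A * \<bar>?\<Delta>\<bar> \<le> W2 \<mu> \<nu>"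
    using coupling_bound \<open>0 < A\<close> by (intro le_W2I) auto
  with \<open>0 < A\<close> show ?thesis by simp
qed

end
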